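(* Let $X=\mathrm{Spec}(\mathbb{C}[S])$ be an affine toric variety and let $H=\{\nu_1,\dots,\nu_r\}\subset \overset{\circ}{\sigma}\cap N$ be a finite set of monomial divisorial valuations. Then the Poincaré series $P_{X,H}(\underline t)$ of the multi-index filtration on $\mathcal{O}_{X,o}$ defined by $H$ is the image under $\Phi$ of the multi-graded Poincaré series $Q(\underline u)=\sum_{s\in S}\underline u^{s}$ of the semigroup $S$, i.e. $$P_{X,H}(\underline t)=\Phi(Q(\underline u)).$$
   Context: Setting: $N=\mathbb{Z}^d$, $M$ is the dual lattice with pairing $\langle m,n\rangle$. $\sigma\subset N\otimes_{\mathbb Z}\mathbb{R}$ is a rational polyhedral strongly convex $d$-dimensional cone with interior $\overset{\circ}{\sigma}$, and $\check\sigma$ is its dual cone. $S\subset\check\sigma\cap M$ is a finitely generated semigroup (containing $0$) which generates $\check\sigma$ as a cone and $M$ as a group. $\mathbb{C}[S]=\bigoplus_{s\in S}\mathbb{C}\chi^s$, $X=\mathrm{Spec}(\mathbb{C}[S])$ (not necessarily normal), $o\in X$ is the unique $0$-dimensional torus orbit (whose maximal ideal in $\mathbb{C}[S]$ is spanned by the $\chi^s$, $s\neq0$), and $\mathcal{O}_{X,o}$ is the ring of germs at $o$. Monomial valuations: a lattice point $\nu\in\overset{\circ}{\sigma}\cap N$ defines the valuation $\nu\big(\sum_{m\in F}a_m\chi^m\big)=\min\{\langle m,\nu\rangle\mid m\in F,\ a_m\neq 0\}$; it is a valuation centred at the maximal ideal of $\mathcal{O}_{X,o}$ (primitive lattice points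 give the normalized valuations). The lattice point and the valuation are identified. Write $\underline\nu=(\nu_1,\dots,\nu_r)$ and $\langle s,\underline\nu\rangle=(\langle s,\nu_1\rangle,\dots,\langle s,\nu_r\rangle)$. Poincaré series: for $\underline v\in\mathbb{Z}^r$ put $I(\underline v)=\{g\in\mathcal{O}_{X,o}\mid \nu_i(g)\ge v_i,\ 1\le i\le r\}$, $\underline 1=(1,\dots,1)$, $d(\underline v)=\dim_{\mathbb C} I(\underline v)/I(\underline v+\underline 1)$ (which is finite), and $L(t_1,\dots,t_r)=\sum_{\underline v\in\mathbb{Z}^r}d(\underline v)\,\underline t^{\underline v}$. Then $\prod_{i=1}^r(t_i-1)\,L\in\mathbb{Z}[[t_1,\dots,t_r]]$ and $$P_{X,H}(t_1,\dots,t_r)=\frac{\prod_{i=1}^r(t_i-1)\,L(t_1,\dots,t_r)}{t_1\cdots t_r-1}\in\mathbb{Z}[[t_1,\dots,t_r]].$$ The map $\Phi$: it sends a formal series $\sum_{m}\lambda_m\underline u^{m}$ ($m\in M$) to $\sum_m\lambda_m\underline t^{\langle m,\underline\nu\rangle}$; it is applied here to a series supported on $S$, for which only finitely many $s\in S$ have a given value $\langle s,\underline\nu\rangle$. *)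

theory Defs
  imports
    "HOL-Analysis.Analysis"
    "HOL-Library.Poly_Mapping"
    "HOL-Computational_Algebra.Group_Closure"
    "HOL-Algebra.Algebraic_Closure_Type"
    "Jordan_Normal_Form.Missing_VectorSpace"
begin

section \<open>Lattices and cones\<close>

text \<open>
  The lattice \<open>N\<close> is \<open>\<int>\<^sup>d\<close>, and its dual \<open>M\<close> is identified with \<open>\<int>\<^sup>d\<close> by means of the
  dual basis.  Both are the type \<^typ>\<open>int ^ 'd\<close>.
\<close>

definition pairing :: "int ^ 'd \<Rightarrow> int ^ 'd \<Rightarrow> int" where
  "pairing m n = (\<Sum>i\<in>UNIV. m $ i * n $ i)"

definition lattice_pt :: "int ^ 'd \<Rightarrow> real ^ 'd" where
  "lattice_pt m = (\<chi> i. of_int (m $ i))"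

definition rational_polyhedral_cone :: "(real ^ 'd) set \<Rightarrow> bool" where
  "rational_polyhedral_cone \<sigma> \<longleftrightarrow> (\<exists>F. finite F \<and> \<sigma> = convex_cone hull (lattice_pt ` F))"

definition strongly_convex_cone :: "(real ^ 'd) set \<Rightarrow> bool" where
  "strongly_convex_cone \<sigma> \<longleftrightarrow> \<sigma> \<inter> uminus ` \<sigma> = {0}"

definition dual_cone :: "(real ^ 'd) set \<Rightarrow> (real ^ 'd) set" where
  "dual_cone \<sigma> = {m. \<forall>n\<in>\<sigma>. m \<bullet> n \<ge> 0}"

inductive_set monoid_closure :: "'a::comm_monoid_add set \<Rightarrow> 'a set" for F where
  zero: "0 \<in> monoid_closure F"
| add: "f \<in> F \<Longrightarrow> s \<in> monoid_closure F \<Longrightarrow> f + s \<in> monoid_closure F"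


section \<open>Localizations and quotient spaces\<close>

definition loc_rel :: "('a, 'm) ring_scheme \<Rightarrow> 'a set \<Rightarrow> (('a \<times> 'a) \<times> ('a \<times> 'a)) set" where
  "loc_rel R U = {((a, s), (b, t)) | a s b t.
     a \<in> carrier R \<and> b \<in> carrier R \<and> s \<in> U \<and> t \<in> U \<and>
     (\<exists>u\<in>U. u \<otimes>\<^bsub>R\<^esub> (a \<otimes>\<^bsub>R\<^esub> t) = u \<otimes>\<^bsub>R\<^esub> (b \<otimes>\<^bsub>R\<^esub> s))}"

definition loc_frac :: "('a, 'm) ring_scheme \<Rightarrow> 'a set \<Rightarrow> 'a \<Rightarrow> 'a \<Rightarrow> ('a \<times> 'a) set" where
  "loc_frac R U a s = loc_rel R U `` {(a, s)}"

text \<open>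
  The localization of an algebra at a multiplicative set, again as an algebra.  As in
  \<^theory>\<open>HOL.Equiv_Relations\<close>, the operations are unions over representatives, all of which
  give the same class.
\<close>

definition localization ::
  "('k, 'a, 'm) module_scheme \<Rightarrow> 'a set \<Rightarrow> ('k, ('a \<times> 'a) set) module" where
  "localization R U =
    \<lparr>carrier = (carrier R \<times> U) // loc_rel R U,
     mult = (\<lambda>A B. \<Union>(a, s)\<in>A. \<Union>(b, t)\<in>B. loc_frac R U (a \<otimes>\<^bsub>R\<^esub> b) (s \<otimes>\<^bsub>R\<^esub> t)),
     one = loc_frac R U \<one>\<^bsub>R\<^esub> \<one>\<^bsub>R\<^esub>,
     zero = loc_frac R U \<zero>\<^bsub>R\<^esub> \<one>\<^bsub>R\<^esub>,
     add = (\<lambda>A B. \<Union>(a, s)\<in>A. \<Union>(b, t)\<in>B.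
              loc_frac R U ((a \<otimes>\<^bsub>R\<^esub> t) \<oplus>\<^bsub>R\<^esub> (b \<otimes>\<^bsub>R\<^esub> s)) (s \<otimes>\<^bsub>R\<^esub> t)),
     smult = (\<lambda>c A. \<Union>(a, s)\<in>A. loc_frac R U (c \<odot>\<^bsub>R\<^esub> a) s)\<rparr>"

text \<open>
  The quotient \<open>V / W\<close> of a module by a submodule.  The record type of modules extends that of
  rings, but the multiplicative part plays no role for a module and is left unspecified.
\<close>

definition quotient_module :: "('k, 'a, 'm) module_scheme \<Rightarrow> 'a set \<Rightarrow> ('k, 'a set) module" where
  "quotient_module V W =
    \<lparr>carrier = a_rcosets\<^bsub>V\<^esub> W, mult = undefined, one = undefined,
     zero = W, add = set_add V,
     smult = (\<lambda>c A. \<Union>x\<in>A. W +>\<^bsub>V\<^esub> (c \<odot>\<^bsub>V\<^esub> x))\<rparr>"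


section \<open>The local ring of an affine toric variety at its fixed point\<close>

definition semigroup_algebra ::
  "(int ^ 'd) set \<Rightarrow> (complex, (int ^ 'd) \<Rightarrow>\<^sub>0 complex) module" where
  "semigroup_algebra S =
    \<lparr>carrier = {f. Poly_Mapping.keys f \<subseteq> S}, mult = (*), one = 1, zero = 0, add = (+),
     smult = (\<lambda>c f. Poly_Mapping.single 0 c * f)\<rparr>"

text \<open>The span of the characters \<open>\<chi>\<^sup>s\<close> with \<open>s \<in> S\<close> and \<open>s \<noteq> 0\<close>.\<close>

definition max_ideal :: "(int ^ 'd) set \<Rightarrow> ((int ^ 'd) \<Rightarrow>\<^sub>0 complex) set" where
  "max_ideal S = {f. Poly_Mapping.keys f \<subseteq> S - {0}}"

definition local_ring ::
  "(int ^ 'd) set \<Rightarrow> (complex, (((int ^ 'd) \<Rightarrow>\<^sub>0 complex) \<times> ((int ^ 'd) \<Rightarrow>\<^sub>0 complex)) set) module"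
  where
  "local_ring S =
    localization (semigroup_algebra S) (carrier (semigroup_algebra S) - max_ideal S)"


section \<open>Monomial valuations and the multi-index filtration\<close>

text \<open>The infimum is a minimum unless \<open>f = 0\<close>, when it is \<open>\<infinity>\<close>.\<close>

definition monomial_val :: "int ^ 'd \<Rightarrow> ((int ^ 'd) \<Rightarrow>\<^sub>0 complex) \<Rightarrow> ereal" where
  "monomial_val \<nu> f = (INF m\<in>Poly_Mapping.keys f. ereal (of_int (pairing m \<nu>)))"

text \<open>The value of a germ \<open>f / h\<close> is \<open>\<nu> f - \<nu> h\<close>, for any representative \<open>(f, h)\<close>.\<close>

definition germ_val ::
  "int ^ 'd \<Rightarrow> (((int ^ 'd) \<Rightarrow>\<^sub>0 complex) \<times> ((int ^ 'd) \<Rightarrow>\<^sub>0 complex)) set \<Rightarrow> ereal" where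
  "germ_val \<nu> g = the_elem ((\<lambda>(f, h). monomial_val \<nu> f - monomial_val \<nu> h) ` g)"

definition filtration ::
  "(int ^ 'd) set \<Rightarrow> ('r::finite \<Rightarrow> int ^ 'd) \<Rightarrow> int ^ 'r \<Rightarrow>
    (((int ^ 'd) \<Rightarrow>\<^sub>0 complex) \<times> ((int ^ 'd) \<Rightarrow>\<^sub>0 complex)) set set" where
  "filtration S \<nu> v =
    {g \<in> carrier (local_ring S). \<forall>i. germ_val (\<nu> i) g \<ge> ereal (of_int (v $ i))}"

text \<open>Note that \<^term>\<open>1 :: int ^ 'r\<close> is the vector \<open>(1, \<dots>, 1)\<close>.\<close>

definition filtration_dim ::
  "(int ^ 'd) set \<Rightarrow> ('r::finite \<Rightarrow> int ^ 'd) \<Rightarrow> int ^ 'r \<Rightarrow> nat" where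
  "filtration_dim S \<nu> v =
    vectorspace.dim (ring_of_type_algebra :: complex ring)
      (quotient_module ((local_ring S) \<lparr>carrier := filtration S \<nu> v\<rparr>) (filtration S \<nu> (v + 1)))"


section \<open>Formal series\<close>

text \<open>
  A formal series \<open>\<Sum>v. a v * t\<^sup>v\<close> with integer coefficients and exponents in \<open>\<int>\<^sup>r\<close> is its family of
  coefficients.  Such series can be multiplied by Laurent polynomials, but not by each other.
\<close>

type_synonym 'r formal_series = "int ^ 'r \<Rightarrow> int"

definition poly_mult ::
  "((int ^ 'r) \<Rightarrow>\<^sub>0 int) \<Rightarrow> ('r::finite) formal_series \<Rightarrow> 'r formal_series" where
  "poly_mult p A = (\<lambda>v. \<Sum>m\<in>Poly_Mapping.keys p. Poly_Mapping.lookup p m * A (v - m))"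

definition indet :: "'r::finite \<Rightarrow> (int ^ 'r) \<Rightarrow>\<^sub>0 int" where
  "indet i = Poly_Mapping.single (axis i 1) 1"

definition power_series :: "('r::finite) formal_series set" where
  "power_series = {A. \<forall>v. A v \<noteq> 0 \<longrightarrow> (\<forall>i. v $ i \<ge> 0)}"

definition L_series ::
  "(int ^ 'd) set \<Rightarrow> ('r::finite \<Rightarrow> int ^ 'd) \<Rightarrow> 'r formal_series" where
  "L_series S \<nu> = (\<lambda>v. int (filtration_dim S \<nu> v))"

text \<open>
  The quotient of \<open>\<Prod>i. (t\<^sub>i - 1) * L\<close> by \<open>t\<^sub>1 \<cdots> t\<^sub>r - 1\<close> is taken in the ring of power series, where
  the divisor is a unit.  Among all formal series it would not be unique.
\<close>

definition poincare_series ::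
  "(int ^ 'd) set \<Rightarrow> ('r::finite \<Rightarrow> int ^ 'd) \<Rightarrow> 'r formal_series" where
  "poincare_series S \<nu> =
    (THE P. P \<in> power_series \<and>
       poly_mult ((\<Prod>i\<in>UNIV. indet i) - 1) P =
       poly_mult (\<Prod>i\<in>UNIV. (indet i - 1)) (L_series S \<nu>))"

definition semigroup_series :: "(int ^ 'd) set \<Rightarrow> ('d::finite) formal_series" where
  "semigroup_series S = (\<lambda>s. if s \<in> S then 1 else 0)"

definition Phi ::
  "('r::finite \<Rightarrow> int ^ 'd) \<Rightarrow> ('d::finite) formal_series \<Rightarrow> 'r formal_series" where
  "Phi \<nu> A = (\<lambda>w. \<Sum>m | A m \<noteq> 0 \<and> (\<chi> i. pairing m (\<nu> i)) = w. A m)"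

end

theory Submission
  imports Defs "Jordan_Normal_Form.VS_Connect"
begin

text \<open>
  Write \<open>w(s) = \<langle>s, \<nu>\<rangle>\<close> for the vector of weights of \<open>s \<in> S\<close>. Since the points \<open>\<nu>\<^sub>i\<close> lie in the interior of
  the cone, all entries of \<open>w(s)\<close> are positive for \<open>s \<noteq> 0\<close>, and only finitely many \<open>s\<close> have a given bound
  on one of their weights (\<open>interior_pairing_bound\<close>).

  Consequently a germ \<open>f / h\<close> at the fixed point has the same values as its numerator: the denominator has a nonzero
  constant term and hence value \<open>0\<close> (\<open>germ_val_frac\<close>). Modulo \<open>I(v + 1)\<close> a germ in \<open>I(v)\<close> is
  unchanged when \<open>h\<close> is replaced by its constant term, because elements of the maximal ideal raise all values by
  at least \<open>1\<close>. So \<open>I(v) / I(v + 1)\<close> has a basis of classes of characters, and \<open>d(v)\<close> is the number of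
  \<open>s \<in> S\<close> with \<open>v \<le> w(s)\<close> but not \<open>v + 1 \<le> w(s)\<close> (\<open>filtration_dim_eq\<close>).

  Therefore \<open>L\<close> is the sum over \<open>s \<in> S\<close> of the orthant series \<open>\<Sum>v\<le>w(s). t\<^sup>v\<close> minus the one
  with \<open>w(s)\<close> replaced by \<open>w(s) - 1\<close>. Multiplication by \<open>\<Prod>i. (t\<^sub>i - 1)\<close> turns the orthant series
  below \<open>w\<close> into the monomial with exponent \<open>w + 1\<close>, so each \<open>s\<close> contributes
  \<open>(t\<^sub>1 \<cdots> t\<^sub>r - 1) t\<^bsup>w(s)\<^esup>\<close> (\<open>poly_mult_prod_indet_minus_one_card\<close>). Division by
  \<open>t\<^sub>1 \<cdots> t\<^sub>r - 1\<close>, which is unique among power series, leaves \<open>\<Sum>s. t\<^bsup>w(s)\<^esup>\<close>.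
\<close>

(* The dollar sign is reserved for the coordinates of lattice vectors. *)
no_notation vec_index (infixl \<open>$\<close> 100)
no_notation fps_nth (infixl \<open>$\<close> 75)


section \<open>Multiplying formal series by products of \<open>t\<^sub>i - 1\<close>\<close>

lemma lookup_single_times:
  fixes f :: "'a::cancel_comm_monoid_add \<Rightarrow>\<^sub>0 'b::semiring_0"
  shows "Poly_Mapping.lookup (Poly_Mapping.single m c * f) (m + k) = c * Poly_Mapping.lookup f k"
  by (simp add: lookup_mult lookup_single when_mult)

lemma poly_mult_superset:
  assumes "finite F" "Poly_Mapping.keys p \<subseteq> F"
  shows "poly_mult p A v = (\<Sum>m\<in>F. Poly_Mapping.lookup p m * A (v - m))"
  unfolding poly_mult_def
  by (rule sum.mono_neutral_left) (use assms in \<open>auto simp: in_keys_iff\<close>)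

lemma poly_mult_diff: "poly_mult (p - q) A v = poly_mult p A v - poly_mult q A v"
proof -
  let ?F = "Poly_Mapping.keys p \<union> Poly_Mapping.keys q"
  have "Poly_Mapping.keys (p - q) \<subseteq> ?F"
    by (auto simp: in_keys_iff lookup_minus)
  then show ?thesis
    by (simp add: poly_mult_superset[where F = ?F] lookup_minus left_diff_distrib sum_subtractf)
qed

lemma poly_mult_single_times:
  "poly_mult (Poly_Mapping.single m c * q) A v = c * poly_mult q A (v - m)"
proof -
  have "Poly_Mapping.keys (Poly_Mapping.single m c * q) \<subseteq> (\<lambda>k. m + k) ` Poly_Mapping.keys q"
    using keys_mult[of "Poly_Mapping.single m c" q] by (auto split: if_splits)
  then have "poly_mult (Poly_Mapping.single m c * q) A v =
      (\<Sum>k\<in>Poly_Mapping.keys q. c * Poly_Mapping.lookup q k * A (v - (m + k)))"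
    by (subst poly_mult_superset) (auto simp: sum.reindex inj_on_def lookup_single_times)
  then show ?thesis
    by (simp add: poly_mult_def sum_distrib_left algebra_simps)
qed

lemma poly_mult_one: "poly_mult 1 A v = A v"
  by (simp add: poly_mult_def)

lemma poly_mult_series_sum:
  "poly_mult p (\<lambda>v. \<Sum>s\<in>F. A s v) v = (\<Sum>s\<in>F. poly_mult p (A s) v)"
  unfolding poly_mult_def by (simp add: sum_distrib_left sum.swap[of _ F])

lemma poly_mult_series_diff:
  "poly_mult p (\<lambda>v. A v - B v) v = poly_mult p A v - poly_mult p B v"
  unfolding poly_mult_def by (simp add: right_diff_distrib sum_subtractf)

lemma prod_indet:
  "finite K \<Longrightarrow> (\<Prod>i\<in>K. indet i) = Poly_Mapping.single (\<Sum>i\<in>K. axis i 1) 1"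
  by (induction K rule: finite_induct) (auto simp: indet_def mult_single)

lemma poly_mult_prod_indet_minus_one:
  "poly_mult ((\<Prod>i\<in>(UNIV::'r::finite set). indet i) - 1) A v = A (v - 1) - A v"
proof -
  have "(\<Sum>i\<in>(UNIV::'r set). axis i 1) = (1 :: int ^ 'r)"
    by (simp add: Finite_Cartesian_Product.vec_eq_iff) (simp add: axis_def)
  then have "poly_mult (\<Prod>i\<in>(UNIV::'r set). indet i) A v = A (v - 1)"
    using poly_mult_single_times[of "1 :: int ^ 'r" 1 1 A v] by (simp add: prod_indet poly_mult_one)
  then show ?thesis
    by (simp add: poly_mult_diff poly_mult_one)
qed

text \<open>
  A single vector \<open>w\<close> contributes to \<open>L\<close> a difference of two series of the form
  \<open>\<Sum>v\<le>w. t\<^sup>v\<close>, an orthant that is unbounded below. Each factor \<open>t\<^sub>i - 1\<close> takes a difference in the \<open>i\<close>-th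
  direction and collapses the half line \<open>v\<^sub>i \<le> w\<^sub>i\<close> to the point \<open>v\<^sub>i = w\<^sub>i + 1\<close>; the induction
  on \<open>K\<close> does this one direction at a time.
\<close>

lemma poly_mult_prod_below:
  fixes w :: "int ^ 'r::finite"
  assumes "finite K"
  shows "poly_mult (\<Prod>i\<in>K. indet i - 1) (\<lambda>v. of_bool (v \<le> w)) v =
    of_bool (\<forall>i. if i \<in> K then v $ i = w $ i + 1 else v $ i \<le> w $ i)"
  using assms
proof (induction K arbitrary: v rule: finite_induct)
  case empty
  then show ?case
    by (simp add: poly_mult_one Finite_Cartesian_Product.less_eq_vec_def)
next
  case (insert j K)
  let ?q = "\<Prod>i\<in>K. indet i - 1"
  let ?A = "\<lambda>v. of_bool (v \<le> w)"
  define C where "C \<longleftrightarrow> (\<forall>i. i \<noteq> j \<longrightarrow> (if i \<in> K then v $ i = w $ i + 1 else v $ i \<le> w $ i))"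
  have split: "(\<forall>i. if i \<in> K then u $ i = w $ i + 1 else u $ i \<le> w $ i) \<longleftrightarrow> C \<and> u $ j \<le> w $ j"
    if "\<And>i. i \<noteq> j \<Longrightarrow> u $ i = v $ i" for u
    using that insert.hyps(2) unfolding C_def by metis
  have ins: "(\<forall>i. if i \<in> insert j K then v $ i = w $ i + 1 else v $ i \<le> w $ i)
      \<longleftrightarrow> C \<and> v $ j = w $ j + 1"
    unfolding C_def by (metis insert_iff)
  have "poly_mult (\<Prod>i\<in>insert j K. indet i - 1) ?A v =
      poly_mult (indet j * ?q - ?q) ?A v"
    using insert.hyps by (simp add: left_diff_distrib)
  also have "\<dots> = poly_mult ?q ?A (v - axis j 1) - poly_mult ?q ?A v"
    by (simp add: poly_mult_diff indet_def poly_mult_single_times)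
  also have "\<dots> = of_bool (C \<and> (v - axis j 1) $ j \<le> w $ j) - of_bool (C \<and> v $ j \<le> w $ j)"
    unfolding insert.IH by (subst (1 2) split) (auto simp: axis_def)
  also have "\<dots> = of_bool (C \<and> v $ j = w $ j + 1)"
    by (auto simp: axis_def)
  finally show ?case
    unfolding ins .
qed

corollary poly_mult_prod_below_UNIV:
  fixes w :: "int ^ 'r::finite"
  shows "poly_mult (\<Prod>i\<in>UNIV. indet i - 1) (\<lambda>v. of_bool (v \<le> w)) v = of_bool (w = v - 1)"
  unfolding poly_mult_prod_below[OF finite] Finite_Cartesian_Product.vec_eq_iff
  by (rule arg_cong[where f = of_bool], rule all_cong1) auto

text \<open>
  An element \<open>s\<close> lies in \<open>D v\<close> if and only if \<open>v\<close> lies in the orthant below \<open>w s\<close> but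
  not in the smaller one below \<open>w s - 1\<close>, so it contributes the difference of two
  orthant series. After multiplication by all \<open>t\<^sub>i - 1\<close> these become the monomials at \<open>w s + 1\<close>
  and at \<open>w s\<close>, whose difference is \<open>(t\<^sub>1 \<cdots> t\<^sub>r - 1) t\<^bsup>w s\<^esup>\<close>.
  As \<open>S\<close> may be infinite, the sum over \<open>S\<close> is formed coefficientwise: a single coefficient of the product involves
  only the finite set \<open>F\<close> of elements of \<open>S\<close>.
\<close>

lemma poly_mult_prod_indet_minus_one_card:
  fixes w :: "'s \<Rightarrow> int ^ 'r::finite" and S :: "'s set"
  defines "D \<equiv> \<lambda>v. {s \<in> S. v \<le> w s \<and> \<not> v + 1 \<le> w s}"
  assumes fin: "\<And>v. finite (D v)"
  shows "poly_mult (\<Prod>i\<in>UNIV. indet i - 1) (\<lambda>v. int (card (D v))) =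
    poly_mult ((\<Prod>i\<in>UNIV. indet i) - 1) (\<lambda>v. int (card {s \<in> S. w s = v}))"
proof
  fix v :: "int ^ 'r"
  define p :: "(int ^ 'r) \<Rightarrow>\<^sub>0 int" where "p = (\<Prod>i\<in>UNIV. indet i - 1)"
  define F where "F = D v \<union> D (v - 1) \<union> (\<Union>m\<in>Poly_Mapping.keys p. D (v - m))"
  have finF: "finite F"
    using fin by (auto simp: F_def)
  define B :: "'s \<Rightarrow> int ^ 'r \<Rightarrow> int" where "B = (\<lambda>s u. of_bool (u \<le> w s) - of_bool (u \<le> w s - 1))"
  have FS: "F \<subseteq> S"
    by (auto simp: F_def D_def)
  \<comment> \<open>The multiplication evaluates \<open>D\<close> only at the points \<open>v - m\<close>, where \<open>D\<close> lies inside \<open>F\<close>.\<close>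
  have D_iff: "int (card (D u)) = (\<Sum>s\<in>F. B s u)" if "D u \<subseteq> F" for u
  proof -
    have "B s u = of_bool (s \<in> D u)" if "s \<in> F" for s
    proof -
      have "u \<le> w s - 1 \<longleftrightarrow> u + 1 \<le> w s"
        by (simp add: Finite_Cartesian_Product.less_eq_vec_def algebra_simps)
      moreover have "u \<le> w s" if le: "u + 1 \<le> w s"
        unfolding Finite_Cartesian_Product.less_eq_vec_def
      proof
        fix i show "u $ i \<le> w s $ i"
          using le[unfolded Finite_Cartesian_Product.less_eq_vec_def, rule_format, of i] by simp
      qed
      ultimately show ?thesis
        using that FS by (auto simp: B_def D_def)
    qed
    then have "(\<Sum>s\<in>F. B s u) = (\<Sum>s\<in>F. of_bool (s \<in> D u))"
      by simp
    also have "\<dots> = int (card (D u))"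
      using that finF by (simp add: Int_absorb1)
    finally show ?thesis ..
  qed
  have at: "int (card {s \<in> S. w s = u}) = (\<Sum>s\<in>F. of_bool (w s = u))" if "D u \<subseteq> F" for u
  proof -
    have "{s \<in> S. w s = u} \<subseteq> D u"
      by (auto simp: D_def Finite_Cartesian_Product.less_eq_vec_def)
    then have "{s \<in> S. w s = u} = {s \<in> F. w s = u}"
      using that FS by blast
    then show ?thesis
      using finF by (simp add: Int_def)
  qed
  have "poly_mult p (\<lambda>v. int (card (D v))) v = poly_mult p (\<lambda>u. \<Sum>s\<in>F. B s u) v"
    unfolding poly_mult_def by (rule sum.cong, simp, subst D_iff) (auto simp: F_def)
  also have "\<dots> = (\<Sum>s\<in>F. of_bool (w s = v - 1) - of_bool (w s = v))"
    unfolding poly_mult_series_sum B_def poly_mult_series_diff p_def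
    by (intro sum.cong refl) (simp add: poly_mult_prod_below_UNIV algebra_simps eq_commute)
  also have "\<dots> = int (card {s \<in> S. w s = v - 1}) - int (card {s \<in> S. w s = v})"
    by (subst (1 2) at) (auto simp: F_def sum_subtractf)
  finally show "poly_mult (\<Prod>i\<in>UNIV. indet i - 1) (\<lambda>v. int (card (D v))) v =
      poly_mult ((\<Prod>i\<in>UNIV. indet i) - 1) (\<lambda>v. int (card {s \<in> S. w s = v})) v"
    by (simp add: p_def poly_mult_prod_indet_minus_one)
qed

text \<open>
  A difference \<open>E\<close> of two quotients is invariant under translation by \<open>(1, \<dots>, 1)\<close>. Translating
  backwards leads to exponents with a negative entry, where power series have no terms.
\<close>

lemma power_series_division_unique:
  assumes P: "P \<in> power_series" "Q \<in> (power_series :: 'r::finite formal_series set)"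
    and eq: "poly_mult ((\<Prod>i\<in>UNIV. indet i) - 1) P = poly_mult ((\<Prod>i\<in>UNIV. indet i) - 1) Q"
  shows "P = Q"
proof
  fix v :: "int ^ 'r"
  define E where "E = (\<lambda>v. P v - Q v)"
  have step: "E (v - 1) = E v" for v
    using fun_cong[OF eq, of v] by (simp add: E_def poly_mult_prod_indet_minus_one)
  have "E (v - of_nat n) = E v" for n
  proof (induction n)
    case (Suc n)
    then show ?case
      using step[of "v - of_nat n"] by (simp add: algebra_simps)
  qed simp
  moreover have "E u = 0" if "u $ i < 0" for u i
    using P that unfolding power_series_def E_def by (simp add: linorder_not_le) (metis diff_self linorder_not_le)
  moreover have "(v - of_nat (nat (v $ i) + 1)) $ i < 0" for i
    by (simp add: of_nat_index del: of_nat_add of_nat_Suc)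
  ultimately have "E v = 0"
    by metis
  then show "P v = Q v"
    by (simp add: E_def)
qed


section \<open>Localization of an algebra as a module\<close>

text \<open>
  As \<open>U\<close> may contain zero divisors, \<open>a / s = b / t\<close> means \<open>u a t = u b s\<close> for some
  \<open>u \<in> U\<close>; the proofs of identities between fractions carry such factors along.
\<close>

locale algebra_localization = algebra K A for K and A (structure) +
  fixes U
  assumes U_subset: "U \<subseteq> carrier A"
    and one_U: "\<one> \<in> U"
    and mult_U: "s \<in> U \<Longrightarrow> t \<in> U \<Longrightarrow> s \<otimes> t \<in> U"
begin

abbreviation frac where "frac \<equiv> loc_frac A U"

lemma U_closed [simp]: "s \<in> U \<Longrightarrow> s \<in> carrier A"
  using U_subset by blast

lemma one_U_mult_U [simp, intro]: "\<one> \<in> U" "s \<in> U \<Longrightarrow> t \<in> U \<Longrightarrow> s \<otimes> t \<in> U"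
  by (rule one_U, rule mult_U)

lemma loc_rel_iff:
  "((a, s), (b, t)) \<in> loc_rel A U \<longleftrightarrow> a \<in> carrier A \<and> b \<in> carrier A \<and> s \<in> U \<and> t \<in> U \<and>
    (\<exists>u\<in>U. u \<otimes> (a \<otimes> t) = u \<otimes> (b \<otimes> s))"
  by (simp add: loc_rel_def)

lemma loc_rel_trans:
  assumes "((a, s), (b, t)) \<in> loc_rel A U" "((b, t), (c, w)) \<in> loc_rel A U"
  shows "((a, s), (c, w)) \<in> loc_rel A U"
proof -
  obtain u u' where U: "u \<in> U" "u' \<in> U" "s \<in> U" "t \<in> U" "w \<in> U"
    and A: "a \<in> carrier A" "b \<in> carrier A" "c \<in> carrier A"
    and eqs: "u \<otimes> (a \<otimes> t) = u \<otimes> (b \<otimes> s)" "u' \<otimes> (b \<otimes> w) = u' \<otimes> (c \<otimes> t)"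
    using assms by (auto simp only: loc_rel_iff)
  note cl = A U[THEN U_closed]
  have "(u \<otimes> u' \<otimes> t) \<otimes> (a \<otimes> w) = u' \<otimes> w \<otimes> (u \<otimes> (a \<otimes> t))"
    using cl by (simp add: m_ac)
  also have "\<dots> = u' \<otimes> w \<otimes> (u \<otimes> (b \<otimes> s))"
    by (simp only: eqs(1))
  also have "\<dots> = u \<otimes> s \<otimes> (u' \<otimes> (b \<otimes> w))"
    using cl by (simp add: m_ac)
  also have "\<dots> = u \<otimes> s \<otimes> (u' \<otimes> (c \<otimes> t))"
    by (simp only: eqs(2))
  also have "\<dots> = (u \<otimes> u' \<otimes> t) \<otimes> (c \<otimes> s)"
    using cl by (simp add: m_ac)
  finally show ?thesis
    unfolding loc_rel_iff using A U mult_U[OF mult_U[OF U(1,2)] U(4)] by blast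
qed

lemma equiv_loc_rel: "equiv (carrier A \<times> U) (loc_rel A U)"
proof (rule equivI)
  show "loc_rel A U \<subseteq> (carrier A \<times> U) \<times> (carrier A \<times> U)"
    by (auto simp: loc_rel_def)
  show "refl_on (carrier A \<times> U) (loc_rel A U)"
    using one_U by (auto simp: refl_on_def loc_rel_iff)
  show "sym (loc_rel A U)"
    by (auto simp: sym_def loc_rel_iff eq_commute)
  show "trans (loc_rel A U)"
    by (rule transI) (metis loc_rel_trans surj_pair)
qed

lemma frac_eq_iff:
  assumes "a \<in> carrier A" "s \<in> U" "b \<in> carrier A" "t \<in> U"
  shows "frac a s = frac b t \<longleftrightarrow> (\<exists>u\<in>U. u \<otimes> (a \<otimes> t) = u \<otimes> (b \<otimes> s))"
  unfolding loc_frac_def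
  by (subst eq_equiv_class_iff[OF equiv_loc_rel]) (use assms in \<open>simp_all add: loc_rel_iff\<close>)

lemma frac_eqI:
  assumes "a \<in> carrier A" "s \<in> U" "b \<in> carrier A" "t \<in> U" "a \<otimes> t = b \<otimes> s"
  shows "frac a s = frac b t"
  unfolding frac_eq_iff[OF assms(1-4)] by (rule bexI[OF _ one_U]) (simp only: assms(5))

lemma mem_frac_iff:
  assumes "a \<in> carrier A" "s \<in> U"
  shows "(b, t) \<in> frac a s \<longleftrightarrow> b \<in> carrier A \<and> t \<in> U \<and> frac b t = frac a s"
proof -
  have "(b, t) \<in> frac a s \<longleftrightarrow> ((a, s), (b, t)) \<in> loc_rel A U"
    by (simp add: loc_frac_def)
  also have "\<dots> \<longleftrightarrow> b \<in> carrier A \<and> t \<in> U \<and> frac b t = frac a s"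
    using assms frac_eq_iff[of b t a s] frac_eq_iff[of a s b t] by (auto simp add: loc_rel_iff)
  finally show ?thesis .
qed

lemma carrier_localization: "carrier (localization A U) = {frac a s | a s. a \<in> carrier A \<and> s \<in> U}"
  by (auto simp: localization_def quotient_def loc_frac_def)

lemma frac_in_carrier: "a \<in> carrier A \<Longrightarrow> s \<in> U \<Longrightarrow> frac a s \<in> carrier (localization A U)"
  by (auto simp: carrier_localization)

text \<open>
  The operations on fractions are unions over all representatives; when the value does
  not depend on the representative, the union is that value.
\<close>

lemma UN_frac:
  assumes "a \<in> carrier A" "s \<in> U"
    and "\<And>b t. b \<in> carrier A \<Longrightarrow> t \<in> U \<Longrightarrow> frac b t = frac a s \<Longrightarrow> F b t = F a s"
  shows "(\<Union>(b, t)\<in>frac a s. F b t) = F a s"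
proof -
  have "frac a s \<noteq> {}"
    using mem_frac_iff[OF assms(1,2), of a s] assms(1,2) by auto
  moreover have "(case x of (b, t) \<Rightarrow> F b t) = F a s" if "x \<in> frac a s" for x
    using that mem_frac_iff[OF assms(1,2)] assms(3) by (cases x) simp
  ultimately show ?thesis
    by (rule SUP_eq_const)
qed

lemma frac_add_cong:
  assumes "a \<in> carrier A" "s \<in> U" "b \<in> carrier A" "t \<in> U"
    "a' \<in> carrier A" "s' \<in> U" "b' \<in> carrier A" "t' \<in> U"
    and "frac a s = frac a' s'" "frac b t = frac b' t'"
  shows "frac (a \<otimes> t \<oplus> b \<otimes> s) (s \<otimes> t) = frac (a' \<otimes> t' \<oplus> b' \<otimes> s') (s' \<otimes> t')"
proof -
  obtain u w where U: "u \<in> U" "w \<in> U"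
    and eqs: "u \<otimes> (a \<otimes> s') = u \<otimes> (a' \<otimes> s)" "w \<otimes> (b \<otimes> t') = w \<otimes> (b' \<otimes> t)"
    using assms(9,10) frac_eq_iff[of a s a' s'] frac_eq_iff[of b t b' t'] assms(1-8) by auto
  note cl = assms(1-8) U U_closed[OF assms(2)] U_closed[OF assms(4)] U_closed[OF assms(6)]
    U_closed[OF assms(8)] U[THEN U_closed]
  have "(u \<otimes> w) \<otimes> ((a \<otimes> t \<oplus> b \<otimes> s) \<otimes> (s' \<otimes> t')) =
      w \<otimes> (t \<otimes> t') \<otimes> (u \<otimes> (a \<otimes> s')) \<oplus> u \<otimes> (s \<otimes> s') \<otimes> (w \<otimes> (b \<otimes> t'))"
    using cl by (simp add: m_ac l_distr r_distr)
  also have "\<dots> = w \<otimes> (t \<otimes> t') \<otimes> (u \<otimes> (a' \<otimes> s)) \<oplus> u \<otimes> (s \<otimes> s') \<otimes> (w \<otimes> (b' \<otimes> t))"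
    by (simp only: eqs)
  also have "\<dots> = (u \<otimes> w) \<otimes> ((a' \<otimes> t' \<oplus> b' \<otimes> s') \<otimes> (s \<otimes> t))"
    using cl by (simp add: m_ac l_distr r_distr)
  finally show ?thesis
    using cl by (subst frac_eq_iff) auto
qed

lemma add_frac:
  assumes "a \<in> carrier A" "s \<in> U" "b \<in> carrier A" "t \<in> U"
  shows "frac a s \<oplus>\<^bsub>localization A U\<^esub> frac b t = frac (a \<otimes> t \<oplus> b \<otimes> s) (s \<otimes> t)"
proof -
  let ?F = "\<lambda>a s. \<Union>(b, t)\<in>frac b t. frac (a \<otimes> t \<oplus> b \<otimes> s) (s \<otimes> t)"
  have inner: "?F a' s' = frac (a' \<otimes> t \<oplus> b \<otimes> s') (s' \<otimes> t)" if "a' \<in> carrier A" "s' \<in> U" for a' s'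
    by (rule UN_frac[OF assms(3,4)]; rule frac_add_cong) (simp_all add: that assms)
  have "(\<Union>(a, s)\<in>frac a s. ?F a s) = ?F a s"
  proof (rule UN_frac[OF assms(1,2)])
    fix a' s' assume *: "a' \<in> carrier A" "s' \<in> U" "frac a' s' = frac a s"
    show "?F a' s' = ?F a s"
      unfolding inner[OF *(1,2)] inner[OF assms(1,2)]
      by (rule frac_add_cong) (simp_all add: * assms)
  qed
  then show ?thesis
    by (simp add: localization_def inner[OF assms(1,2)])
qed

lemma mult_smult:
  assumes "c \<in> carrier K" "x \<in> carrier A" "y \<in> carrier A"
  shows "x \<otimes> (c \<odot> y) = c \<odot> (x \<otimes> y)"
  using assms m_comm[of x "c \<odot> y"] m_comm[of x y] by (simp add: smult_assoc2)

lemma smult_frac: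
  assumes "c \<in> carrier K" "a \<in> carrier A" "s \<in> U"
  shows "c \<odot>\<^bsub>localization A U\<^esub> frac a s = frac (c \<odot> a) s"
proof -
  have "frac (c \<odot> b) t = frac (c \<odot> a) s"
    if bt: "b \<in> carrier A" "t \<in> U" "frac b t = frac a s" for b t
  proof -
    obtain u where u: "u \<in> U" "u \<otimes> (b \<otimes> s) = u \<otimes> (a \<otimes> t)"
      using bt(3) unfolding frac_eq_iff[OF bt(1,2) assms(2,3)] by blast
    have "u \<otimes> ((c \<odot> b) \<otimes> s) = c \<odot> (u \<otimes> (b \<otimes> s))"
      using bt(1,2) assms u(1) by (simp add: smult_assoc2 mult_smult)
    also have "\<dots> = c \<odot> (u \<otimes> (a \<otimes> t))"
      by (simp only: u(2))
    also have "\<dots> = u \<otimes> ((c \<odot> a) \<otimes> t)"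
      using bt(1,2) assms u(1) by (simp add: smult_assoc2 mult_smult)
    finally show ?thesis
      using bt(1,2) assms u(1) frac_eq_iff[of "c \<odot> b" t "c \<odot> a" s] by blast
  qed
  then have "(\<Union>(a, s)\<in>frac a s. frac (c \<odot> a) s) = frac (c \<odot> a) s"
    by (rule UN_frac[OF assms(2,3), where F = "\<lambda>a s. frac (c \<odot> a) s"])
  then show ?thesis
    by (simp add: localization_def)
qed

lemma frac_cancel:
  assumes "a \<in> carrier A" "s \<in> U" "t \<in> U"
  shows "frac (a \<otimes> t) (s \<otimes> t) = frac a s"
  by (rule frac_eqI) (use assms in \<open>simp_all add: m_ac\<close>)

lemma add_frac_same:
  assumes "a \<in> carrier A" "b \<in> carrier A" "s \<in> U"
  shows "frac a s \<oplus>\<^bsub>localization A U\<^esub> frac b s = frac (a \<oplus> b) s"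
  using assms frac_cancel[of "a \<oplus> b" s s] by (simp add: add_frac l_distr)

lemma zero_localization: "s \<in> U \<Longrightarrow> \<zero>\<^bsub>localization A U\<^esub> = frac \<zero> s"
  by (simp add: localization_def) (rule frac_eqI; simp)

lemma abelian_group_localization: "abelian_group (localization A U)"
proof (rule abelian_groupI)
  show "\<zero>\<^bsub>localization A U\<^esub> \<in> carrier (localization A U)"
    by (simp add: zero_localization[OF one_U] frac_in_carrier)
next
  fix x assume "x \<in> carrier (localization A U)"
  then obtain a s where x: "x = frac a s" "a \<in> carrier A" "s \<in> U"
    by (auto simp: carrier_localization)
  show "\<zero>\<^bsub>localization A U\<^esub> \<oplus>\<^bsub>localization A U\<^esub> x = x"
    using x by (simp add: zero_localization[OF x(3)] add_frac_same)
  show "\<exists>y\<in>carrier (localization A U). y \<oplus>\<^bsub>localization A U\<^esub> x = \<zero>\<^bsub>localization A U\<^esub>"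
    using x by (intro bexI[of _ "frac (\<ominus> a) s"])
      (simp_all add: zero_localization[OF x(3)] add_frac_same l_neg frac_in_carrier)
next
  fix x y assume "x \<in> carrier (localization A U)" "y \<in> carrier (localization A U)"
  then obtain a s b t where x: "x = frac a s" "a \<in> carrier A" "s \<in> U"
    and y: "y = frac b t" "b \<in> carrier A" "t \<in> U"
    by (auto simp: carrier_localization)
  show "x \<oplus>\<^bsub>localization A U\<^esub> y \<in> carrier (localization A U)"
    using x y by (simp add: add_frac frac_in_carrier)
  show "x \<oplus>\<^bsub>localization A U\<^esub> y = y \<oplus>\<^bsub>localization A U\<^esub> x"
    using x y by (simp add: add_frac m_comm a_comm)
  fix z assume "z \<in> carrier (localization A U)"
  then obtain c w where z: "z = frac c w" "c \<in> carrier A" "w \<in> U"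
    by (auto simp: carrier_localization)
  show "x \<oplus>\<^bsub>localization A U\<^esub> y \<oplus>\<^bsub>localization A U\<^esub> z = x \<oplus>\<^bsub>localization A U\<^esub> (y \<oplus>\<^bsub>localization A U\<^esub> z)"
    using x y z by (simp add: add_frac l_distr r_distr m_ac a_ac)
qed

lemma module_localization: "module K (localization A U)"
proof (rule moduleI)
  fix c x assume c: "c \<in> carrier K" and "x \<in> carrier (localization A U)"
  then obtain a s where x: "x = frac a s" "a \<in> carrier A" "s \<in> U"
    by (auto simp: carrier_localization)
  show "c \<odot>\<^bsub>localization A U\<^esub> x \<in> carrier (localization A U)"
    using c x by (simp add: smult_frac frac_in_carrier)
  fix d assume d: "d \<in> carrier K"
  show "(c \<oplus>\<^bsub>K\<^esub> d) \<odot>\<^bsub>localization A U\<^esub> x =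
      c \<odot>\<^bsub>localization A U\<^esub> x \<oplus>\<^bsub>localization A U\<^esub> d \<odot>\<^bsub>localization A U\<^esub> x"
    using c d x by (simp add: smult_frac add_frac_same smult_l_distr)
  show "(c \<otimes>\<^bsub>K\<^esub> d) \<odot>\<^bsub>localization A U\<^esub> x =
      c \<odot>\<^bsub>localization A U\<^esub> (d \<odot>\<^bsub>localization A U\<^esub> x)"
    using c d x by (simp add: smult_frac smult_assoc1)
next
  fix c x y
  assume c: "c \<in> carrier K" and "x \<in> carrier (localization A U)" "y \<in> carrier (localization A U)"
  then obtain a s b t where x: "x = frac a s" "a \<in> carrier A" "s \<in> U"
    and y: "y = frac b t" "b \<in> carrier A" "t \<in> U"
    by (auto simp: carrier_localization)
  show "c \<odot>\<^bsub>localization A U\<^esub> (x \<oplus>\<^bsub>localization A U\<^esub> y) =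
      c \<odot>\<^bsub>localization A U\<^esub> x \<oplus>\<^bsub>localization A U\<^esub> c \<odot>\<^bsub>localization A U\<^esub> y"
    using c x y by (simp add: smult_frac add_frac smult_r_distr smult_assoc2)
next
  fix x assume "x \<in> carrier (localization A U)"
  then show "\<one>\<^bsub>K\<^esub> \<odot>\<^bsub>localization A U\<^esub> x = x"
    by (auto simp: carrier_localization smult_frac)
qed (auto intro: abelian_group_localization R_cring)

end


section \<open>Quotient modules and their dimension\<close>

locale module_quotient = Module.module K V for K and V (structure) +
  fixes W
  assumes W: "Module.submodule W K V"
begin

sublocale W: abelian_subgroup W V
  by (rule abelian_subgroupI3)
    (use W abelian_group_axioms in \<open>auto simp: Module.submodule_def additive_subgroup_def\<close>)

lemma W_sub: "W \<subseteq> carrier V"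
  using submoduleE(1)[OF W] .

lemma carrier_quotient: "carrier (quotient_module V W) = {W +> x | x. x \<in> carrier V}"
  by (auto simp: quotient_module_def A_RCOSETS_def')

lemma coset_in_quotient: "x \<in> carrier V \<Longrightarrow> W +> x \<in> carrier (quotient_module V W)"
  by (auto simp: carrier_quotient)

lemma coset_eqI: "w \<in> W \<Longrightarrow> x \<in> carrier V \<Longrightarrow> W +> (w \<oplus> x) = W +> x"
  by (rule W.a_repr_independence'[symmetric]) (auto simp: a_r_coset_def')

lemma zero_quotient: "\<zero>\<^bsub>quotient_module V W\<^esub> = W +> \<zero>"
  using W_sub by (simp add: quotient_module_def a_coset_add_zero)

lemma coset_eq_zero_iff: "x \<in> carrier V \<Longrightarrow> W +> x = \<zero>\<^bsub>quotient_module V W\<^esub> \<longleftrightarrow> x \<in> W"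
  using W_sub W.a_rcos_self[of x] coset_eqI[of x \<zero>]
  by (auto simp: zero_quotient a_coset_add_zero)

lemma add_coset:
  "x \<in> carrier V \<Longrightarrow> y \<in> carrier V \<Longrightarrow> (W +> x) \<oplus>\<^bsub>quotient_module V W\<^esub> (W +> y) = W +> (x \<oplus> y)"
  by (simp add: quotient_module_def W.a_rcos_sum)

lemma smult_coset:
  assumes c: "c \<in> carrier K" and x: "x \<in> carrier V"
  shows "c \<odot>\<^bsub>quotient_module V W\<^esub> (W +> x) = W +> (c \<odot> x)"
proof -
  have const: "W +> (c \<odot> y) = W +> (c \<odot> x)" if y: "y \<in> W +> x" for y
  proof -
    obtain w where w: "w \<in> W" "y = w \<oplus> x"
      using y by (auto simp: a_r_coset_def')
    then have "c \<odot> y = c \<odot> w \<oplus> c \<odot> x"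
      using c x W_sub by (simp add: smult_r_distr subset_iff)
    then show ?thesis
      using coset_eqI[of "c \<odot> w" "c \<odot> x"] submoduleE(4)[OF W c w(1)] c x by simp
  qed
  have "W +> x \<noteq> {}"
    using W.a_rcos_self[OF x] by auto
  then have "(\<Union>y\<in>W +> x. W +> (c \<odot> y)) = W +> (c \<odot> x)"
    by (rule SUP_eq_const[OF _ const])
  then show ?thesis
    by (simp add: quotient_module_def)
qed

lemma abelian_group_quotient: "abelian_group (quotient_module V W)"
proof (rule abelian_groupI)
  show "\<zero>\<^bsub>quotient_module V W\<^esub> \<in> carrier (quotient_module V W)"
    by (simp add: zero_quotient coset_in_quotient)
next
  fix B assume "B \<in> carrier (quotient_module V W)"
  then obtain x where x: "B = W +> x" "x \<in> carrier V"
    by (auto simp: carrier_quotient)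
  show "\<zero>\<^bsub>quotient_module V W\<^esub> \<oplus>\<^bsub>quotient_module V W\<^esub> B = B"
    using x by (simp add: zero_quotient add_coset)
  show "\<exists>C\<in>carrier (quotient_module V W). C \<oplus>\<^bsub>quotient_module V W\<^esub> B = \<zero>\<^bsub>quotient_module V W\<^esub>"
    using x by (intro bexI[of _ "W +> (\<ominus> x)"])
      (simp_all add: zero_quotient add_coset coset_in_quotient M.l_neg)
next
  fix B C assume "B \<in> carrier (quotient_module V W)" "C \<in> carrier (quotient_module V W)"
  then obtain x y where x: "B = W +> x" "x \<in> carrier V" and y: "C = W +> y" "y \<in> carrier V"
    by (auto simp: carrier_quotient)
  show "B \<oplus>\<^bsub>quotient_module V W\<^esub> C \<in> carrier (quotient_module V W)"
    using x y by (simp add: add_coset coset_in_quotient)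
  show "B \<oplus>\<^bsub>quotient_module V W\<^esub> C = C \<oplus>\<^bsub>quotient_module V W\<^esub> B"
    using x y by (simp add: add_coset M.a_comm)
  fix D assume "D \<in> carrier (quotient_module V W)"
  then obtain z where z: "D = W +> z" "z \<in> carrier V"
    by (auto simp: carrier_quotient)
  show "B \<oplus>\<^bsub>quotient_module V W\<^esub> C \<oplus>\<^bsub>quotient_module V W\<^esub> D =
      B \<oplus>\<^bsub>quotient_module V W\<^esub> (C \<oplus>\<^bsub>quotient_module V W\<^esub> D)"
    using x y z by (simp add: add_coset M.a_assoc)
qed

lemma module_quotient: "Module.module K (quotient_module V W)"
proof (rule moduleI)
  fix c B assume c: "c \<in> carrier K" and "B \<in> carrier (quotient_module V W)"
  then obtain x where x: "B = W +> x" "x \<in> carrier V"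
    by (auto simp: carrier_quotient)
  show "c \<odot>\<^bsub>quotient_module V W\<^esub> B \<in> carrier (quotient_module V W)"
    using c x by (simp add: smult_coset coset_in_quotient)
  fix d assume d: "d \<in> carrier K"
  show "(c \<oplus>\<^bsub>K\<^esub> d) \<odot>\<^bsub>quotient_module V W\<^esub> B =
      c \<odot>\<^bsub>quotient_module V W\<^esub> B \<oplus>\<^bsub>quotient_module V W\<^esub> d \<odot>\<^bsub>quotient_module V W\<^esub> B"
    using c d x by (simp add: smult_coset add_coset smult_l_distr)
  show "(c \<otimes>\<^bsub>K\<^esub> d) \<odot>\<^bsub>quotient_module V W\<^esub> B =
      c \<odot>\<^bsub>quotient_module V W\<^esub> (d \<odot>\<^bsub>quotient_module V W\<^esub> B)"
    using c d x by (simp add: smult_coset smult_assoc1)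
next
  fix c B C
  assume c: "c \<in> carrier K" and "B \<in> carrier (quotient_module V W)" "C \<in> carrier (quotient_module V W)"
  then obtain x y where x: "B = W +> x" "x \<in> carrier V" and y: "C = W +> y" "y \<in> carrier V"
    by (auto simp: carrier_quotient)
  show "c \<odot>\<^bsub>quotient_module V W\<^esub> (B \<oplus>\<^bsub>quotient_module V W\<^esub> C) =
      c \<odot>\<^bsub>quotient_module V W\<^esub> B \<oplus>\<^bsub>quotient_module V W\<^esub> c \<odot>\<^bsub>quotient_module V W\<^esub> C"
    using c x y by (simp add: smult_coset add_coset smult_r_distr)
next
  fix B assume "B \<in> carrier (quotient_module V W)"
  then show "\<one>\<^bsub>K\<^esub> \<odot>\<^bsub>quotient_module V W\<^esub> B = B"
    by (auto simp: carrier_quotient smult_coset)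
qed (auto intro: abelian_group_quotient R.cring_axioms)

end

lemma ring_of_type_algebra_eq_class_ring: "(ring_of_type_algebra :: 'k::field ring) = class_ring"
  by (simp add: ring_of_type_algebra_def)

text \<open>
  Counting dimensions by coordinates: a linear map defined on all families of scalars that only sees
  the entries over \<open>I\<close>, is injective on them and reaches every vector, is an isomorphism from
  the standard space of dimension \<open>card I\<close>. Families are indexed by an arbitrary finite set, so that
  the characters themselves can serve as indices.
\<close>

lemma dim_eq_card:
  fixes V :: "('k::field, 'v) module" and T :: "('i \<Rightarrow> 'k) \<Rightarrow> 'v"
  assumes V: "Module.module ring_of_type_algebra V"
    and I: "finite I"
    and closed: "\<And>f. T f \<in> carrier V"
    and add: "\<And>f g. T (\<lambda>i. f i + g i) = T f \<oplus>\<^bsub>V\<^esub> T g"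
    and smult: "\<And>c f. T (\<lambda>i. c * f i) = c \<odot>\<^bsub>V\<^esub> T f"
    and surj: "\<And>x. x \<in> carrier V \<Longrightarrow> \<exists>f. x = T f"
    and cong: "\<And>f g. (\<And>i. i \<in> I \<Longrightarrow> f i = g i) \<Longrightarrow> T f = T g"
    and ker: "\<And>f i. T f = \<zero>\<^bsub>V\<^esub> \<Longrightarrow> i \<in> I \<Longrightarrow> f i = 0"
  shows "vectorspace.dim (ring_of_type_algebra :: 'k ring) V = card I"
proof -
  let ?n = "card I"
  let ?U = "module_vec TYPE('k) ?n"
  obtain e where e: "bij_betw e I {0..<?n}"
    using ex_bij_betw_finite_nat[OF I] by blast
  define T' where "T' x = T (\<lambda>i. vec_index x (e i))" for x
  have e_less: "e i < ?n" if "i \<in> I" for i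
    using e that by (auto simp: bij_betw_def)
  interpret U: vectorspace "class_ring :: 'k ring" ?U
    by (rule vec_vs)
  interpret V: vectorspace "class_ring :: 'k ring" V
    using V by (simp add: vectorspace_def class_field ring_of_type_algebra_eq_class_ring)
  have eq_iff: "T f = T g \<longleftrightarrow> (\<forall>i\<in>I. f i = g i)" for f g
  proof
    assume "T f = T g"
    then have "T (\<lambda>i. f i - g i) \<oplus>\<^bsub>V\<^esub> T g = T g"
      using add[of "\<lambda>i. f i - g i" g] by simp
    then have "T (\<lambda>i. f i - g i) = \<zero>\<^bsub>V\<^esub>"
      using closed V.add.r_cancel_one by blast
    then show "\<forall>i\<in>I. f i = g i"
      using ker by fastforce
  qed (auto intro: cong)
  have lin: "linear_map class_ring ?U V T'"
  proof -
    have "T' (x + y) = T' x \<oplus>\<^bsub>V\<^esub> T' y" if "x \<in> carrier_vec ?n" "y \<in> carrier_vec ?n" for x y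
    proof -
      have "T' (x + y) = T (\<lambda>i. vec_index x (e i) + vec_index y (e i))"
        unfolding T'_def eq_iff using that e_less by auto
      then show ?thesis
        by (simp add: add T'_def)
    qed
    moreover have "T' (c \<cdot>\<^sub>v x) = c \<odot>\<^bsub>V\<^esub> T' x" if "x \<in> carrier_vec ?n" for c x
    proof -
      have "T' (c \<cdot>\<^sub>v x) = T (\<lambda>i. c * vec_index x (e i))"
        unfolding T'_def eq_iff using that e_less by auto
      then show ?thesis
        by (simp add: smult T'_def)
    qed
    ultimately have "mod_hom_axioms class_ring ?U V T'"
      unfolding mod_hom_axioms_def module_hom_def
      by (auto simp: module_vec_simps T'_def closed)
    then show ?thesis
      by (simp add: linear_map_def mod_hom_def U.vectorspace_axioms V.vectorspace_axioms
          U.module_axioms V.module_axioms)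
  qed
  have "inj_on T' (carrier ?U)"
  proof (rule inj_onI)
    fix x y assume xy: "x \<in> carrier ?U" "y \<in> carrier ?U" and "T' x = T' y"
    then have eq: "\<forall>k\<in>I. vec_index x (e k) = vec_index y (e k)"
      by (simp add: T'_def eq_iff)
    show "x = y"
    proof (rule eq_vecI)
      fix j assume "j < dim_vec y"
      then have "j \<in> e ` I"
        using xy e by (auto simp: module_vec_simps bij_betw_def)
      then show "vec_index x j = vec_index y j"
        using eq by blast
    qed (use xy in \<open>simp add: module_vec_simps\<close>)
  qed
  moreover have "T' ` carrier ?U = carrier V"
  proof (intro equalityI subsetI)
    fix x assume "x \<in> carrier V"
    then obtain f where f: "x = T f"
      using surj by blast
    define y where "y = vec ?n (\<lambda>j. f (the_inv_into I e j))"
    have "T' y = T f"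
      unfolding T'_def eq_iff y_def using e e_less by (auto simp: bij_betw_def the_inv_into_f_f)
    moreover have "y \<in> carrier ?U"
      by (simp add: y_def module_vec_simps)
    ultimately show "x \<in> T' ` carrier ?U"
      unfolding f by (metis image_eqI)
  qed (auto simp: T'_def closed)
  ultimately have "U.dim = V.dim"
    by (intro linear_map.dim_eq[OF lin] vec_space.fin_dim)
  then show ?thesis
    by (simp add: ring_of_type_algebra_eq_class_ring vec_space.dim_is_n)
qed


section \<open>The monomial filtration of the local ring\<close>

lemma pairing_zero [simp]: "pairing 0 n = 0"
  by (simp add: pairing_def)

lemma pairing_add: "pairing (a + b) n = pairing a n + pairing b n"
  by (simp add: pairing_def algebra_simps sum.distrib)

text \<open>
  Positivity makes \<open>0\<close> the element of least weight in \<open>S\<close>, so that an element of the algebra with nonzero constant term has value \<open>0\<close>.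
\<close>

locale positive_monoid =
  fixes S :: "(int ^ 'd::finite) set" and \<nu> :: "'r::finite \<Rightarrow> int ^ 'd"
  assumes zero_mem: "0 \<in> S"
    and add_mem: "a \<in> S \<Longrightarrow> b \<in> S \<Longrightarrow> a + b \<in> S"
    and pairing_pos: "s \<in> S \<Longrightarrow> s \<noteq> 0 \<Longrightarrow> 0 < pairing s (\<nu> i)"
begin

abbreviation "SA \<equiv> semigroup_algebra S"
definition U where "U = carrier SA - max_ideal S"
abbreviation "\<KK> \<equiv> (ring_of_type_algebra :: complex ring)"

lemma pairing_nonneg: "s \<in> S \<Longrightarrow> 0 \<le> pairing s (\<nu> i)"
  using pairing_pos[of s i] by (cases "s = 0") auto

lemma semigroup_algebra_simps:
  "carrier SA = {f. Poly_Mapping.keys f \<subseteq> S}"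
  "f \<otimes>\<^bsub>SA\<^esub> g = f * g" "f \<oplus>\<^bsub>SA\<^esub> g = f + g" "\<one>\<^bsub>SA\<^esub> = 1" "\<zero>\<^bsub>SA\<^esub> = 0"
  "c \<odot>\<^bsub>SA\<^esub> f = Poly_Mapping.single 0 c * f"
  by (simp_all add: semigroup_algebra_def)

lemma type_algebra_simps:
  "carrier \<KK> = UNIV" "c \<otimes>\<^bsub>\<KK>\<^esub> d = c * d" "c \<oplus>\<^bsub>\<KK>\<^esub> d = c + d" "\<one>\<^bsub>\<KK>\<^esub> = 1" "\<zero>\<^bsub>\<KK>\<^esub> = 0"
  by (simp_all add: ring_of_type_algebra_def)

lemma U_iff: "h \<in> U \<longleftrightarrow> Poly_Mapping.keys h \<subseteq> S \<and> Poly_Mapping.lookup h 0 \<noteq> 0"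
  by (auto simp: U_def semigroup_algebra_simps max_ideal_def in_keys_iff)

lemma keys_plus_subset:
  "Poly_Mapping.keys f \<subseteq> S \<Longrightarrow> Poly_Mapping.keys g \<subseteq> S \<Longrightarrow> Poly_Mapping.keys (f + g) \<subseteq> S"
  using keys_add[of f g] by blast

lemma keys_times_subset:
  "Poly_Mapping.keys f \<subseteq> S \<Longrightarrow> Poly_Mapping.keys g \<subseteq> S \<Longrightarrow> Poly_Mapping.keys (f * g) \<subseteq> S"
  using keys_mult[of f g] add_mem by blast

lemma keys_scalar_times:
  "Poly_Mapping.keys (Poly_Mapping.single 0 c * f) \<subseteq> Poly_Mapping.keys f"
  for f :: "(int ^ 'd) \<Rightarrow>\<^sub>0 complex"
  using lookup_single_times[of 0 c f] by (auto simp: in_keys_iff)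

text \<open>
  The nonconstant terms of \<open>u\<close> raise the value of every monomial of \<open>f\<close>, so they cannot
  contribute at a monomial \<open>m\<close> whose value is at most the value of \<open>f\<close>. Hence the lowest terms of
  \<open>f\<close> survive multiplication by \<open>u\<close> when its constant term is nonzero.
\<close>

lemma lookup_times_lowest:
  fixes u f :: "(int ^ 'd) \<Rightarrow>\<^sub>0 complex"
  assumes u: "Poly_Mapping.keys u \<subseteq> S"
    and m: "\<And>a. a \<in> Poly_Mapping.keys f \<Longrightarrow> pairing m (\<nu> i) \<le> pairing a (\<nu> i)"
  shows "Poly_Mapping.lookup (u * f) m = Poly_Mapping.lookup u 0 * Poly_Mapping.lookup f m"
proof -
  define c where "c = Poly_Mapping.single (0 :: int ^ 'd) (Poly_Mapping.lookup u 0)"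
  have p: "a \<in> S \<and> a \<noteq> 0" if "a \<in> Poly_Mapping.keys (u - c)" for a
    using that u by (auto simp: c_def in_keys_iff lookup_minus lookup_single when_def split: if_splits)
  have "m \<notin> Poly_Mapping.keys ((u - c) * f)"
  proof
    assume "m \<in> Poly_Mapping.keys ((u - c) * f)"
    then obtain a b where "m = a + b" "a \<in> Poly_Mapping.keys (u - c)" "b \<in> Poly_Mapping.keys f"
      using keys_mult[of "u - c" f] by blast
    then show False
      using m[of b] p[of a] pairing_pos[of a i] by (simp add: pairing_add)
  qed
  moreover have "u * f = c * f + (u - c) * f"
    by (simp add: algebra_simps)
  ultimately show ?thesis
    using lookup_single_times[of 0 "Poly_Mapping.lookup u 0" f m]
    by (simp add: lookup_add in_keys_iff c_def)
qed

lemma monomial_val_unit_times: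
  assumes "u \<in> U"
  shows "monomial_val (\<nu> i) (u * f) = monomial_val (\<nu> i) f"
proof (rule antisym)
  have u: "Poly_Mapping.keys u \<subseteq> S" "Poly_Mapping.lookup u 0 \<noteq> 0"
    using assms by (simp_all add: U_iff)
  show "monomial_val (\<nu> i) f \<le> monomial_val (\<nu> i) (u * f)"
    unfolding monomial_val_def
  proof (rule INF_greatest)
    fix m assume "m \<in> Poly_Mapping.keys (u * f)"
    then obtain a b where ab: "m = a + b" "a \<in> Poly_Mapping.keys u" "b \<in> Poly_Mapping.keys f"
      using keys_mult[of u f] by blast
    then have "pairing b (\<nu> i) \<le> pairing m (\<nu> i)"
      using u pairing_nonneg[of a i] by (auto simp: pairing_add)
    then show "(INF m\<in>Poly_Mapping.keys f. ereal (of_int (pairing m (\<nu> i)))) \<le> ereal (of_int (pairing m (\<nu> i)))"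
      by (intro INF_lower2[OF ab(3)]) simp
  qed
  show "monomial_val (\<nu> i) (u * f) \<le> monomial_val (\<nu> i) f"
  proof (cases "f = 0")
    case False
    then obtain m where m: "m \<in> Poly_Mapping.keys f"
      "\<And>a. a \<in> Poly_Mapping.keys f \<Longrightarrow> pairing m (\<nu> i) \<le> pairing a (\<nu> i)"
      using arg_min_if_finite[of "Poly_Mapping.keys f" "\<lambda>a. pairing a (\<nu> i)"]
      by (metis finite_keys keys_eq_empty linorder_not_less)
    then have "m \<in> Poly_Mapping.keys (u * f)"
      using lookup_times_lowest[of u f m i, OF u(1) m(2)] u(2) by (simp add: in_keys_iff)
    then have "monomial_val (\<nu> i) (u * f) \<le> ereal (of_int (pairing m (\<nu> i)))"
      unfolding monomial_val_def by (rule INF_lower)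
    also have "\<dots> \<le> monomial_val (\<nu> i) f"
      unfolding monomial_val_def by (rule INF_greatest) (simp add: m(2))
    finally show ?thesis .
  qed simp
qed

lemma monomial_val_unit: "u \<in> U \<Longrightarrow> monomial_val (\<nu> i) u = 0"
  using monomial_val_unit_times[of u i 1] by (simp add: monomial_val_def zero_ereal_def)

lemma algebra_semigroup_algebra: "algebra \<KK> SA"
proof (rule algebraI)
  show "cring \<KK>"
    by (rule cring_from_type_algebra)
  show "cring SA"
  proof (rule cringI)
    show "abelian_group SA"
    proof (rule abelian_groupI)
      fix f assume "f \<in> carrier SA"
      then show "\<exists>g\<in>carrier SA. g \<oplus>\<^bsub>SA\<^esub> f = \<zero>\<^bsub>SA\<^esub>"
        by (intro bexI[of _ "- f"]) (auto simp: semigroup_algebra_simps)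
    qed (auto simp: semigroup_algebra_simps add_ac intro: subsetD[OF keys_plus_subset])
    show "comm_monoid SA"
      by (rule comm_monoidI)
        (auto simp: semigroup_algebra_simps mult_ac zero_mem intro: subsetD[OF keys_times_subset])
  qed (auto simp: semigroup_algebra_simps algebra_simps)
  show "c \<odot>\<^bsub>SA\<^esub> f \<in> carrier SA" if "f \<in> carrier SA" for c f
    using that keys_scalar_times[of c f] by (auto simp: semigroup_algebra_simps)
qed (auto simp: semigroup_algebra_simps type_algebra_simps algebra_simps single_add mult_single
       simp flip: mult.assoc)

sublocale loc: algebra_localization \<KK> SA U
proof (rule algebra_localization.intro[OF algebra_semigroup_algebra], unfold_locales)
  show "U \<subseteq> carrier SA"
    by (auto simp: U_def)
  show "\<one>\<^bsub>SA\<^esub> \<in> U"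
    unfolding U_iff by (simp add: semigroup_algebra_simps zero_mem)
  fix s t assume "s \<in> U" "t \<in> U"
  then show "s \<otimes>\<^bsub>SA\<^esub> t \<in> U"
    using lookup_times_lowest[of s t 0] pairing_nonneg keys_times_subset[of s t]
    by (auto simp: U_iff semigroup_algebra_simps(2) subset_iff)
qed

lemma local_ring_eq: "local_ring S = localization SA U"
  by (simp add: local_ring_def U_def)

text \<open>
  The denominators have value \<open>0\<close>, and passing to an equal fraction multiplies the numerators
  by elements of \<open>U\<close>, which preserve the value. So the value of a germ is that of any numerator.
\<close>

lemma germ_val_frac:
  assumes f: "f \<in> carrier SA" and h: "h \<in> U"
  shows "germ_val (\<nu> i) (loc.frac f h) = monomial_val (\<nu> i) f"
proof -
  have "monomial_val (\<nu> i) g - monomial_val (\<nu> i) k = monomial_val (\<nu> i) f"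
    if gk: "(g, k) \<in> loc.frac f h" for g k
  proof -
    have g: "g \<in> carrier SA" "k \<in> U" "loc.frac g k = loc.frac f h"
      using gk unfolding loc.mem_frac_iff[OF f h] by auto
    then obtain u where u: "u \<in> U" "u * (g * h) = u * (f * k)"
      using loc.frac_eq_iff[OF g(1,2) f h] by (auto simp: semigroup_algebra_simps)
    have "monomial_val (\<nu> i) g = monomial_val (\<nu> i) (u * (h * g))"
      using u h by (simp add: monomial_val_unit_times)
    also have "\<dots> = monomial_val (\<nu> i) (u * (k * f))"
      using u(2) by (simp add: mult_ac)
    also have "\<dots> = monomial_val (\<nu> i) f"
      using u g by (simp add: monomial_val_unit_times)
    finally show ?thesis
      using g by (simp add: monomial_val_unit)
  qed
  moreover have "(f, h) \<in> loc.frac f h"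
    using f h by (simp add: loc.mem_frac_iff)
  ultimately show ?thesis
    unfolding germ_val_def
    by (intro the_elem_image_unique) auto
qed

text \<open>
  The values of a germ are minima over the monomials of a numerator, so the filtration is monomial.
\<close>

lemma frac_in_filtration_iff:
  assumes f: "f \<in> carrier SA" and h: "h \<in> U"
  shows "loc.frac f h \<in> filtration S \<nu> v \<longleftrightarrow>
    (\<forall>m\<in>Poly_Mapping.keys f. \<forall>i. v $ i \<le> pairing m (\<nu> i))"
proof -
  have "loc.frac f h \<in> filtration S \<nu> v \<longleftrightarrow>
      (\<forall>i. ereal (of_int (v $ i)) \<le> monomial_val (\<nu> i) f)"
    by (simp add: filtration_def local_ring_eq loc.frac_in_carrier f h germ_val_frac)
  also have "\<dots> \<longleftrightarrow> (\<forall>m\<in>Poly_Mapping.keys f. \<forall>i. v $ i \<le> pairing m (\<nu> i))"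
    by (auto simp: monomial_val_def le_INF_iff)
  finally show ?thesis .
qed

lemma filtration_cases:
  assumes "g \<in> filtration S \<nu> v"
  obtains f h where "g = loc.frac f h" "f \<in> carrier SA" "h \<in> U"
    "\<And>m i. m \<in> Poly_Mapping.keys f \<Longrightarrow> v $ i \<le> pairing m (\<nu> i)"
proof -
  have "g \<in> carrier (localization SA U)"
    using assms by (simp add: filtration_def local_ring_eq)
  then obtain f h where "g = loc.frac f h" "f \<in> carrier SA" "h \<in> U"
    unfolding loc.carrier_localization by blast
  then show thesis
    using that assms frac_in_filtration_iff by metis
qed

text \<open>
  Bringing fractions to a common denominator multiplies the numerators by elements supported on \<open>S\<close>,
  which cannot lower any value.
\<close>

lemma filtration_submodule: "Module.submodule (filtration S \<nu> v) \<KK> (local_ring S)"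
proof -
  interpret L: Module.module \<KK> "local_ring S"
    unfolding local_ring_eq by (rule loc.module_localization)
  have smult: "c \<odot>\<^bsub>local_ring S\<^esub> x \<in> filtration S \<nu> v" if "x \<in> filtration S \<nu> v" for c x
    using that
  proof (cases rule: filtration_cases)
    case (1 f h)
    have cf: "Poly_Mapping.single 0 c * f \<in> carrier SA"
      using 1(2) keys_scalar_times[of c f] by (auto simp: semigroup_algebra_simps)
    have "c \<odot>\<^bsub>local_ring S\<^esub> x = loc.frac (Poly_Mapping.single 0 c * f) h"
      using 1 loc.smult_frac[of c f h] by (simp add: local_ring_eq type_algebra_simps semigroup_algebra_simps(6))
    moreover have "loc.frac (Poly_Mapping.single 0 c * f) h \<in> filtration S \<nu> v"
      unfolding frac_in_filtration_iff[OF cf 1(3)] using 1(4) keys_scalar_times[of c f] by blast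
    ultimately show ?thesis
      by simp
  qed
  show ?thesis
  proof (rule L.submoduleI)
    show sub: "filtration S \<nu> v \<subseteq> carrier (local_ring S)"
      by (auto simp: filtration_def)
    have "loc.frac 0 1 \<in> filtration S \<nu> v"
      using loc.one_U by (subst frac_in_filtration_iff) (auto simp: semigroup_algebra_simps)
    then show "\<zero>\<^bsub>local_ring S\<^esub> \<in> filtration S \<nu> v"
      using loc.zero_localization[OF loc.one_U] by (simp add: local_ring_eq semigroup_algebra_simps)
    fix x assume x: "x \<in> filtration S \<nu> v"
    have "\<ominus>\<^bsub>local_ring S\<^esub> x = (\<ominus>\<^bsub>\<KK>\<^esub> \<one>\<^bsub>\<KK>\<^esub>) \<odot>\<^bsub>local_ring S\<^esub> x"
      using x sub by (simp add: L.smult_l_minus subset_iff)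
    then show "\<ominus>\<^bsub>local_ring S\<^esub> x \<in> filtration S \<nu> v"
      using smult[OF x] by simp
    fix y assume y: "y \<in> filtration S \<nu> v"
    show "x \<oplus>\<^bsub>local_ring S\<^esub> y \<in> filtration S \<nu> v"
    proof -
      obtain f h where fh: "x = loc.frac f h" "f \<in> carrier SA" "h \<in> U"
        "\<And>m i. m \<in> Poly_Mapping.keys f \<Longrightarrow> v $ i \<le> pairing m (\<nu> i)"
        by (rule filtration_cases[OF x]) blast
      obtain g k where gk: "y = loc.frac g k" "g \<in> carrier SA" "k \<in> U"
        "\<And>m i. m \<in> Poly_Mapping.keys g \<Longrightarrow> v $ i \<le> pairing m (\<nu> i)"
        by (rule filtration_cases[OF y]) blast
      have fk: "f * k + g * h \<in> carrier SA" and hk: "h * k \<in> U"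
        using fh(2,3) gk(2,3) loc.mult_U[of h k] unfolding U_iff
        by (auto simp: semigroup_algebra_simps intro!: keys_plus_subset keys_times_subset
            del: subsetI)
      have le: "v $ i \<le> pairing m (\<nu> i)" if m: "m \<in> Poly_Mapping.keys (f * k + g * h)" for m i
      proof -
        have "m \<in> Poly_Mapping.keys (f * k) \<or> m \<in> Poly_Mapping.keys (g * h)"
          using m keys_add[of "f * k" "g * h"] by blast
        then obtain a b where "m = a + b" "b \<in> S" "v $ i \<le> pairing a (\<nu> i)"
          using keys_mult[of f k] keys_mult[of g h] fh(3,4) gk(3,4) unfolding U_iff by blast
        then show ?thesis
          using pairing_nonneg[of b i] by (simp add: pairing_add)
      qed
      have "x \<oplus>\<^bsub>local_ring S\<^esub> y = loc.frac (f * k + g * h) (h * k)"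
        using fh gk loc.add_frac[of f h g k] by (simp add: local_ring_eq semigroup_algebra_simps)
      moreover have "loc.frac (f * k + g * h) (h * k) \<in> filtration S \<nu> v"
        unfolding frac_in_filtration_iff[OF fk hk] using le by blast
      ultimately show ?thesis
        by simp
    qed
  qed (use smult in auto)
qed

definition weight :: "int ^ 'd \<Rightarrow> int ^ 'r" where
  "weight s = (\<chi> i. pairing s (\<nu> i))"

lemma filtration_antimono: "filtration S \<nu> (v + 1) \<subseteq> filtration S \<nu> v"
proof
  fix g assume "g \<in> filtration S \<nu> (v + 1)"
  then obtain f h where g: "g = loc.frac f h" "f \<in> carrier SA" "h \<in> U"
    "\<And>m i. m \<in> Poly_Mapping.keys f \<Longrightarrow> (v + 1) $ i \<le> pairing m (\<nu> i)"
    by (rule filtration_cases) blast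
  have "v $ i \<le> pairing m (\<nu> i)" if "m \<in> Poly_Mapping.keys f" for m i
    using g(4)[OF that, of i] by simp
  then show "g \<in> filtration S \<nu> v"
    unfolding g(1) frac_in_filtration_iff[OF g(2,3)] by blast
qed

text \<open>
  The quotient \<open>I(v) / I(v + 1)\<close> has the classes of the characters \<open>\<chi>\<^sup>s\<close> as a basis, where \<open>s \<in> S\<close> satisfies
  \<open>v \<le> w(s)\<close> but not \<open>v + 1 \<le> w(s)\<close>. Independence is clear because the
  filtration is monomial. The characters generate because denominators can be replaced by their constant
  terms: if \<open>h = c + p\<close> with \<open>p\<close> in the maximal ideal, then
  \<open>f / h - f / c = - f p / (c h)\<close>, and multiplication by \<open>p\<close> raises every value by at least
  \<open>1\<close>, so the difference lies in \<open>I(v + 1)\<close>.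
\<close>

lemma filtration_dim_eq:
  assumes fin: "finite {s \<in> S. v \<le> weight s \<and> \<not> v + 1 \<le> weight s}"
  shows "filtration_dim S \<nu> v = card {s \<in> S. v \<le> weight s \<and> \<not> v + 1 \<le> weight s}"
proof -
  define D where "D = {s \<in> S. v \<le> weight s \<and> \<not> v + 1 \<le> weight s}"
  have finD: "finite D"
    using fin by (simp add: D_def)
  have D_iff: "s \<in> D \<longleftrightarrow> s \<in> S \<and> (\<forall>i. v $ i \<le> pairing s (\<nu> i)) \<and> \<not> (\<forall>i. v $ i + 1 \<le> pairing s (\<nu> i))" for s
    by (simp add: D_def weight_def Finite_Cartesian_Product.less_eq_vec_def)
  let ?L = "local_ring S"
  define V where "V = ?L\<lparr>carrier := filtration S \<nu> v\<rparr>"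
  define W where "W = filtration S \<nu> (v + 1)"
  have V_simps: "carrier V = filtration S \<nu> v" "add V = add ?L" "smult V = smult ?L"
    by (simp_all add: V_def)
  interpret L: Module.module \<KK> ?L
    unfolding local_ring_eq by (rule loc.module_localization)
  interpret V: Module.module \<KK> V
    unfolding V_def by (rule submodule.submodule_is_module[OF filtration_submodule L.module_axioms])
  interpret Q: module_quotient \<KK> V W
  proof (intro module_quotient.intro module_quotient_axioms.intro V.module_axioms)
    have "Module.module \<KK> (V\<lparr>carrier := W\<rparr>)"
      using submodule.submodule_is_module[OF filtration_submodule L.module_axioms]
      by (simp add: V_def W_def)
    then show "Module.submodule W \<KK> V"
      by (intro V.module_incl_imp_submodule) (simp_all add: V_simps W_def filtration_antimono)
  qed
  define p where "p f = (\<Sum>s\<in>D. Poly_Mapping.single s (f s))" for f :: "int ^ 'd \<Rightarrow> complex"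
  have lookup_p: "Poly_Mapping.lookup (p f) m = (if m \<in> D then f m else 0)" for f m
    using finD by (simp add: p_def lookup_sum lookup_single when_def)
  have keys_p: "Poly_Mapping.keys (p f) \<subseteq> D" for f
    by (auto simp: in_keys_iff lookup_p split: if_splits)
  have p_SA: "p f \<in> carrier SA" for f
    using keys_p[of f] by (auto simp: semigroup_algebra_simps D_iff)
  have one_U: "1 \<in> U"
    using loc.one_U by (simp add: semigroup_algebra_simps)
  have p_I: "loc.frac (p f) 1 \<in> filtration S \<nu> v" for f
    unfolding frac_in_filtration_iff[OF p_SA one_U] using keys_p[of f] D_iff by blast
  define T where "T f = a_r_coset V W (loc.frac (p f) 1)" for f
  have "vectorspace.dim \<KK> (quotient_module V W) = card D"
  proof (rule dim_eq_card[where T = T, OF Q.module_quotient finD])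
    show "T f \<in> carrier (quotient_module V W)" for f
      unfolding T_def by (rule Q.coset_in_quotient) (simp add: V_simps p_I)
    show "T (\<lambda>i. f i + g i) = T f \<oplus>\<^bsub>quotient_module V W\<^esub> T g" for f g
    proof -
      have "loc.frac (p (\<lambda>i. f i + g i)) 1 = loc.frac (p f) 1 \<oplus>\<^bsub>V\<^esub> loc.frac (p g) 1"
        using loc.add_frac_same[OF p_SA p_SA one_U, of f g]
        by (simp add: V_simps local_ring_eq semigroup_algebra_simps p_def single_add sum.distrib)
      then show ?thesis
        using Q.add_coset[of "loc.frac (p f) 1" "loc.frac (p g) 1"] by (simp add: T_def V_simps p_I)
    qed
    show "T (\<lambda>i. c * f i) = c \<odot>\<^bsub>quotient_module V W\<^esub> T f" for c f
    proof -
      have "loc.frac (p (\<lambda>i. c * f i)) 1 = c \<odot>\<^bsub>V\<^esub> loc.frac (p f) 1"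
        using loc.smult_frac[of c, OF _ p_SA one_U, of f]
        by (simp add: V_simps local_ring_eq semigroup_algebra_simps(6) type_algebra_simps
            p_def sum_distrib_left mult_single)
      then show ?thesis
        using Q.smult_coset[of c "loc.frac (p f) 1"] by (simp add: T_def V_simps type_algebra_simps p_I)
    qed
    show "T f = T g" if "\<And>i. i \<in> D \<Longrightarrow> f i = g i" for f g
    proof -
      have "p f = p g"
        unfolding p_def using that by (intro sum.cong) auto
      then show ?thesis
        by (simp add: T_def)
    qed
    show "f s = 0" if "T f = \<zero>\<^bsub>quotient_module V W\<^esub>" "s \<in> D" for f s
    proof (rule ccontr)
      assume "f s \<noteq> 0"
      then have "s \<in> Poly_Mapping.keys (p f)"
        using that by (simp add: in_keys_iff lookup_p)
      moreover have "loc.frac (p f) 1 \<in> W"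
        using that(1) Q.coset_eq_zero_iff[of "loc.frac (p f) 1"] by (simp add: T_def V_simps p_I)
      ultimately have "\<forall>i. (v + 1) $ i \<le> pairing s (\<nu> i)"
        unfolding W_def frac_in_filtration_iff[OF p_SA one_U] by blast
      then show False
        using that(2) D_iff by simp
    qed
    fix B assume "B \<in> carrier (quotient_module V W)"
    then obtain g where B: "B = a_r_coset V W g" and g: "g \<in> filtration S \<nu> v"
      by (auto simp: Q.carrier_quotient V_simps)
    from g obtain f h where f: "g = loc.frac f h" "f \<in> carrier SA" "h \<in> U"
      "\<And>m i. m \<in> Poly_Mapping.keys f \<Longrightarrow> v $ i \<le> pairing m (\<nu> i)"
      by (rule filtration_cases) blast
    define c where "c = Poly_Mapping.lookup h 0"
    have c: "c \<noteq> 0"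
      using f(3) by (simp add: U_iff c_def)
    \<comment> \<open>The coordinates are those of \<open>f / c\<close>, and the remainder \<open>r / h\<close> must lie in \<open>W\<close>.\<close>
    define F where "F = (\<lambda>s. Poly_Mapping.lookup f s / c)"
    define r where "r = f - p F * h"
    have keys_f: "Poly_Mapping.keys f \<subseteq> S" and keys_h: "Poly_Mapping.keys h \<subseteq> S"
      using f(2,3) by (auto simp: semigroup_algebra_simps U_iff)
    have r_SA: "r \<in> carrier SA"
    proof -
      have "p F * h \<in> carrier SA"
        using keys_times_subset[of "p F" h] p_SA[of F] keys_h by (simp add: semigroup_algebra_simps)
      then have "Poly_Mapping.keys (f + - (p F * h)) \<subseteq> S"
        using keys_f by (intro keys_plus_subset) (auto simp: semigroup_algebra_simps)
      then show ?thesis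
        by (simp add: r_def semigroup_algebra_simps)
    qed
    have r_W: "loc.frac r h \<in> W"
      unfolding W_def frac_in_filtration_iff[OF r_SA f(3)]
    proof (intro ballI allI)
      fix m i assume m: "m \<in> Poly_Mapping.keys r"
      \<comment> \<open>Split \<open>r\<close> into the error of replacing \<open>h\<close> by \<open>c\<close> and the monomials of \<open>f\<close> outside \<open>D\<close>.\<close>
      define f' where "f' = Poly_Mapping.single 0 (1 / c) * f"
      have f': "Poly_Mapping.lookup f' a = F a" for a
        using lookup_single_times[of 0 "1 / c" f a] by (simp add: f'_def F_def)
      have f_eq: "f = f' * Poly_Mapping.single 0 c"
      proof -
        have "f' * Poly_Mapping.single 0 c = (Poly_Mapping.single 0 (1 / c) * Poly_Mapping.single 0 c) * f"
          by (simp only: f'_def mult_ac)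
        then show ?thesis
          using c by (simp add: mult_single)
      qed
      have "r = f' * (Poly_Mapping.single 0 c - h) + (f' - p F) * h"
        unfolding r_def by (subst f_eq) (simp add: algebra_simps)
      then have "m \<in> Poly_Mapping.keys (f' * (Poly_Mapping.single 0 c - h)) \<or>
          m \<in> Poly_Mapping.keys ((f' - p F) * h)"
        using m keys_add[of "f' * (Poly_Mapping.single 0 c - h)" "(f' - p F) * h"] by auto
      then show "(v + 1) $ i \<le> pairing m (\<nu> i)"
      proof
        assume "m \<in> Poly_Mapping.keys (f' * (Poly_Mapping.single 0 c - h))"
        then obtain a b where ab: "m = a + b" "a \<in> Poly_Mapping.keys f'"
          "b \<in> Poly_Mapping.keys (Poly_Mapping.single 0 c - h)"
          using keys_mult by blast
        have "a \<in> Poly_Mapping.keys f"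
          using ab(2) by (auto simp: in_keys_iff f' F_def)
        moreover have "b \<in> S" "b \<noteq> 0"
          using ab(3) keys_h by (auto simp: in_keys_iff lookup_minus lookup_single when_def c_def
              split: if_splits)
        ultimately show ?thesis
          using f(4)[of a i] pairing_pos[of b i] by (simp add: ab(1) pairing_add)
      next
        assume "m \<in> Poly_Mapping.keys ((f' - p F) * h)"
        then obtain a b where ab: "m = a + b" "a \<in> Poly_Mapping.keys (f' - p F)"
          "b \<in> Poly_Mapping.keys h"
          using keys_mult by blast
        have a: "a \<in> Poly_Mapping.keys f" "a \<notin> D"
          using ab(2) by (auto simp: in_keys_iff lookup_minus f' F_def lookup_p split: if_splits)
        then have "v $ i + 1 \<le> pairing a (\<nu> i)"
          using f(4)[OF a(1)] keys_f D_iff by blast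
        moreover have "b \<in> S"
          using ab(3) keys_h by blast
        ultimately show ?thesis
          using pairing_nonneg[of b i] by (simp add: ab(1) pairing_add)
      qed
    qed
    have "g = loc.frac r h \<oplus>\<^bsub>V\<^esub> loc.frac (p F) 1"
      using loc.add_frac[OF r_SA f(3) p_SA[of F] one_U]
      by (simp add: f(1) r_def V_simps local_ring_eq semigroup_algebra_simps)
    then have "B = T F"
      using Q.coset_eqI[OF r_W, of "loc.frac (p F) 1"] by (simp add: B T_def V_simps p_I)
    then show "\<exists>f. B = T f"
      by (rule exI[of "\<lambda>f. B = T f" F])
  qed
  then show ?thesis
    by (simp add: filtration_dim_def V_def W_def D_def)
qed

end


section \<open>Interior points of the cone and the Poincare series\<close>

lemma inner_lattice_pt: "lattice_pt m \<bullet> lattice_pt n = of_int (pairing m n)"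
  by (simp add: inner_vec_def lattice_pt_def pairing_def)

text \<open>
  A ball of radius \<open>e\<close> around an interior point \<open>n\<close> lies in the cone. Moving from \<open>n\<close> by \<open>e\<close>
  along the \<open>j\<close>-th axis, against the sign of \<open>m\<^sub>j\<close>, lowers the pairing with \<open>m\<close> by \<open>e \<bar>m\<^sub>j\<bar>\<close>, and
  it is still nonnegative there if \<open>m\<close> is in the dual cone. So the pairing grows linearly in all
  coordinates of \<open>m\<close>. Both the positivity of the weights and the finiteness of the fibres follow.
\<close>

lemma interior_pairing_bound:
  fixes \<sigma> :: "(real ^ 'd::finite) set"
  assumes "lattice_pt n \<in> interior \<sigma>"
  obtains e where "e > 0"
    "\<And>m j. lattice_pt m \<in> dual_cone \<sigma> \<Longrightarrow> e * real_of_int \<bar>m $ j\<bar> \<le> of_int (pairing m n)"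
proof -
  obtain e where e: "e > 0" "cball (lattice_pt n) e \<subseteq> \<sigma>"
    using assms by (auto simp: mem_interior_cball)
  have "e * real_of_int \<bar>m $ j\<bar> \<le> of_int (pairing m n)" if m: "lattice_pt m \<in> dual_cone \<sigma>" for m j
  proof -
    define y :: "real ^ 'd" where "y = axis j (e * of_int (sgn (m $ j)))"
    have "norm y = \<bar>e * of_int (sgn (m $ j))\<bar>"
      by (simp add: y_def norm_eq_sqrt_inner inner_axis_axis flip: power2_eq_square)
    also have "\<dots> \<le> e"
      using e(1) by (simp add: sgn_if)
    finally have "norm y \<le> e" .
    then have "lattice_pt n - y \<in> \<sigma>"
      using e(2) by (auto simp: dist_norm)
    then have "0 \<le> lattice_pt m \<bullet> (lattice_pt n - y)"
      using m by (simp add: dual_cone_def)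
    also have "\<dots> = of_int (pairing m n) - e * real_of_int \<bar>m $ j\<bar>"
      unfolding inner_diff_right inner_lattice_pt y_def inner_axis
      by (simp add: lattice_pt_def sgn_if)
    finally show ?thesis
      by simp
  qed
  then show thesis
    using that e(1) by blast
qed

lemma finite_int_vec_box: "finite {m :: int ^ 'd::finite. \<forall>j. \<bar>m $ j\<bar> \<le> B}"
proof (rule finite_subset)
  show "{m :: int ^ 'd. \<forall>j. \<bar>m $ j\<bar> \<le> B} \<subseteq> vec_lambda ` (UNIV \<rightarrow>\<^sub>E {-B..B})"
  proof
    fix m :: "int ^ 'd" assume "m \<in> {m. \<forall>j. \<bar>m $ j\<bar> \<le> B}"
    then have "m = vec_lambda (vec_nth m)" "vec_nth m \<in> UNIV \<rightarrow>\<^sub>E {-B..B}"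
      by (auto simp: abs_le_iff minus_le_iff)
    then show "m \<in> vec_lambda ` (UNIV \<rightarrow>\<^sub>E {-B..B})"
      by blast
  qed
qed (simp add: finite_PiE)

lemma finite_pairing_le:
  fixes \<sigma> :: "(real ^ 'd::finite) set"
  assumes "lattice_pt ` S \<subseteq> dual_cone \<sigma>" "lattice_pt n \<in> interior \<sigma>"
  shows "finite {s \<in> S. pairing s n \<le> N}"
proof -
  obtain e where e: "e > 0"
    "\<And>m j. lattice_pt m \<in> dual_cone \<sigma> \<Longrightarrow> e * real_of_int \<bar>m $ j\<bar> \<le> of_int (pairing m n)"
    using interior_pairing_bound[OF assms(2)] by blast
  have "{s \<in> S. pairing s n \<le> N} \<subseteq> {m. \<forall>j. \<bar>m $ j\<bar> \<le> \<lfloor>of_int N / e\<rfloor>}"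
  proof safe
    fix s j assume "s \<in> S" "pairing s n \<le> N"
    then have "e * real_of_int \<bar>s $ j\<bar> \<le> of_int N"
      using e(2)[of s j] assms(1) by (smt (verit) image_subset_iff of_int_le_iff)
    then show "\<bar>s $ j\<bar> \<le> \<lfloor>of_int N / e\<rfloor>"
      using e(1) by (simp add: le_floor_iff field_simps)
  qed
  then show ?thesis
    using finite_int_vec_box finite_subset by blast
qed

lemma pairing_pos_of_interior:
  fixes \<sigma> :: "(real ^ 'd::finite) set"
  assumes "lattice_pt s \<in> dual_cone \<sigma>" "lattice_pt n \<in> interior \<sigma>" "s \<noteq> 0"
  shows "0 < pairing s n"
proof -
  obtain e where e: "e > 0" "\<And>j. e * real_of_int \<bar>s $ j\<bar> \<le> of_int (pairing s n)"
    using interior_pairing_bound[OF assms(2)] assms(1) by metis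
  obtain j where "s $ j \<noteq> 0"
    using assms(3) by (auto simp: Finite_Cartesian_Product.vec_eq_iff)
  then have "0 < e * real_of_int \<bar>s $ j\<bar>"
    using e(1) by simp
  then show ?thesis
    using e(2)[of j] by linarith
qed

lemma monoid_closure_add:
  "a \<in> monoid_closure F \<Longrightarrow> b \<in> monoid_closure F \<Longrightarrow> a + b \<in> monoid_closure F"
  by (induction rule: monoid_closure.induct) (auto simp: add.assoc intro: monoid_closure.intros)

lemma Phi_semigroup_series:
  "Phi \<nu> (semigroup_series S) w = int (card {s \<in> S. (\<chi> i. pairing s (\<nu> i)) = w})"
proof -
  have "{m. semigroup_series S m \<noteq> 0 \<and> (\<chi> i. pairing m (\<nu> i)) = w} = {s \<in> S. (\<chi> i. pairing s (\<nu> i)) = w}"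
    by (auto simp: semigroup_series_def)
  then show ?thesis
    by (simp add: Phi_def semigroup_series_def)
qed

theorem theorem1:
  fixes \<sigma> :: "(real ^ 'd::finite) set"
    and S :: "(int ^ 'd) set"
    and \<nu> :: "'r::finite \<Rightarrow> int ^ 'd"
  assumes "rational_polyhedral_cone \<sigma>"
    and "strongly_convex_cone \<sigma>"
    and "dim \<sigma> = CARD('d)"
    and "\<exists>F. finite F \<and> S = monoid_closure F"
    and "lattice_pt ` S \<subseteq> dual_cone \<sigma>"
    and "convex_cone hull (lattice_pt ` S) = dual_cone \<sigma>"
    and "group_closure S = UNIV"
    and "inj \<nu>"
    and "\<And>i. lattice_pt (\<nu> i) \<in> interior \<sigma>"
  shows "poincare_series S \<nu> = Phi \<nu> (semigroup_series S)"
proof -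
  obtain F where S: "S = monoid_closure F"
    using assms(4) by blast
  interpret positive_monoid S \<nu>
  proof
    show "0 \<in> S"
      by (simp add: S monoid_closure.zero)
    show "a + b \<in> S" if "a \<in> S" "b \<in> S" for a b
      using that by (simp add: S monoid_closure_add)
    show "0 < pairing s (\<nu> i)" if "s \<in> S" "s \<noteq> 0" for s i
      using pairing_pos_of_interior[OF _ assms(9) that(2)] assms(5) that(1) by blast
  qed
  have fin: "finite {s \<in> S. v \<le> weight s \<and> \<not> v + 1 \<le> weight s}" for v
  proof (rule finite_subset)
    show "{s \<in> S. v \<le> weight s \<and> \<not> v + 1 \<le> weight s} \<subseteq> (\<Union>i. {s \<in> S. pairing s (\<nu> i) \<le> v $ i})"
      by (auto simp: Finite_Cartesian_Product.less_eq_vec_def weight_def not_le)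
    show "finite (\<Union>i. {s \<in> S. pairing s (\<nu> i) \<le> v $ i})"
      using finite_pairing_le[OF assms(5,9)] by simp
  qed
  let ?P = "Phi \<nu> (semigroup_series S)"
  have P: "?P = (\<lambda>v. int (card {s \<in> S. weight s = v}))"
    by (simp add: fun_eq_iff Phi_semigroup_series weight_def)
  have L: "L_series S \<nu> = (\<lambda>v. int (card {s \<in> S. v \<le> weight s \<and> \<not> v + 1 \<le> weight s}))"
    by (simp add: L_series_def filtration_dim_eq fin)
  have mult: "poly_mult ((\<Prod>i\<in>UNIV. indet i) - 1) ?P = poly_mult (\<Prod>i\<in>UNIV. indet i - 1) (L_series S \<nu>)"
    unfolding P L by (rule poly_mult_prod_indet_minus_one_card[symmetric]) (rule fin)
  have P_power: "?P \<in> power_series"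
    unfolding P power_series_def
  proof (intro CollectI allI impI)
    fix v i assume "int (card {s \<in> S. weight s = v}) \<noteq> 0"
    then obtain s where "s \<in> S" "weight s = v"
      by (metis (mono_tags, lifting) card.empty empty_Collect_eq of_nat_0)
    then show "0 \<le> v $ i"
      using pairing_nonneg[of s i] by (auto simp: weight_def)
  qed
  show ?thesis
    unfolding poincare_series_def
  proof (rule the_equality)
    show "?P \<in> power_series \<and> poly_mult ((\<Prod>i\<in>UNIV. indet i) - 1) ?P =
        poly_mult (\<Prod>i\<in>UNIV. indet i - 1) (L_series S \<nu>)"
      using P_power mult by blast
    fix Q :: "'r formal_series"
    assume Q: "Q \<in> power_series \<and> poly_mult ((\<Prod>i\<in>UNIV. indet i) - 1) Q =
        poly_mult (\<Prod>i\<in>UNIV. indet i - 1) (L_series S \<nu>)"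
    show "Q = ?P"
      by (rule power_series_division_unique) (use Q P_power mult in simp_all)
  qed
qed

end
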